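(* Let $G$ be a non-commutative group, let $Z<G$ be a non-trivial central subgroup, and let $k\ge 1$ be a natural number. Let $\mathcal{H}_{Z,k}(G)$ be the cube-structure on $G$ in which a map $c:\{0,1\}^n\to G$ is a cube if and only if there are $f\in C^n(\mathcal{D}_k(Z))$ and $g\in C^n(\mathcal{D}_1(G))$ such that $c(x)=f(x)g(x)$ for every $x\in\{0,1\}^n$. Then $\mathcal{H}_{Z,k}(G)$ is a $k$-step groupspace.
   Context: Notation: $[n]=\{1,\dots,n\}$; $\{0,1\}^0$ is a one point set; $1^n$ is the all-one vector; $\{0,1\}^n_*=\{0,1\}^n\setminus\{1^n\}$; $h(v)=\sum_i v_i$. $\mathcal{G}$-morphisms: a map $\phi:\{0,1\}^n\to\{0,1\}^m$ is a morphism in $\mathcal{G}$ if for every $i\in[m]$ the function $v\mapsto\phi(v)_i$ is either constant (then put $\gamma_\phi(i)=0$) or equal to $v\mapsto v_j$ or $v\mapsto 1-v_j$ for some $j\in[n]$ (then put $\gamma_\phi(i)=j$), and for all $1\le i<j\le m$ either $\gamma_\phi(j)=0$ or $\gamma_\phi(i)\le\gamma_\phi(j)$. For $i\in[n]$, $j\in\{0,1\}$ the face embedding $e^n_{i,j}:\{0,1\}^{n-1}\to\{0,1\}^n$ is $e^n_{i,j}(x_1,\dots,x_{n-1})=(x_1,\dots,x_{i-1},j,x_i,\dots,x_{n-1})$. A cube-structure is a set $X$ with subsets $C^n(X)\subseteq X^{\{0,1\}^n}$ for $n=0,1,2,\dots$. It is a groupspace if: (presheaf) $\psi\in C^m(X)$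 and $\phi:\{0,1\}^n\to\{0,1\}^m$ a morphism in $\mathcal{G}$ imply $\psi\circ\phi\in C^n(X)$; (ergodicity) $C^1(X)=X^{\{0,1\}}$; (completion) for every $n\ge 0$, if $f:\{0,1\}^n_*\to X$ satisfies $f\circ e^n_{i,0}\in C^{n-1}(X)$ for all $i\in[n]$, then some $\phi\in C^n(X)$ restricts to $f$ on $\{0,1\}^n_*$. A groupspace is $k$-step if for $n=k+1$ the completion $\phi$ is always uniquely determined by $f$. For a group $G$, $\mathcal{D}_1(G)$ is the cube-structure on $G$ whose $n$-cubes are the maps $v\mapsto a_0a_1^{v_1}\cdots a_n^{v_n}$ with $a_0,\dots,a_n\in G$. For an abelian group $A$ (written additively) and $k\ge1$, $\mathcal{D}_k(A)$ is the cube-structure on $A$ whose $n$-cubes are the maps $f:\{0,1\}^n\to A$ such that $\sum_{u\le v}(-1)^{h(u)}f(u)=0$ for every $v\in\{0,1\}^n$ with $h(v)\ge k+1$ (the sum is over $u\in\{0,1\}^n$ with $u_i\le v_i$ for all $i$). This is applied to the abelian group $A=Z$. *)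

theory Defs
  imports "HOL-Algebra.Coset" "HOL-Algebra.FiniteProduct"
begin

section \<open>Discrete cubes\<close>

text \<open>
  A vertex of the \<open>n\<close>-cube is an extensional function on \<open>{1..n}\<close>, and maps defined on (parts of)
  a cube are extensional as well. In this way \<open>cube 0\<close> has exactly one element, equality of maps is
  equality of functions, and coordinates are numbered from 1.
\<close>

definition cube :: "nat \<Rightarrow> (nat \<Rightarrow> nat) set" where
  "cube n = ({1..n} \<rightarrow>\<^sub>E {0, 1})"

definition ones :: "nat \<Rightarrow> nat \<Rightarrow> nat" where
  "ones n = (\<lambda>i\<in>{1..n}. 1)"

definition punctured_cube :: "nat \<Rightarrow> (nat \<Rightarrow> nat) set" where
  "punctured_cube n = cube n - {ones n}"

definition height :: "nat \<Rightarrow> (nat \<Rightarrow> nat) \<Rightarrow> nat" where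
  "height n v = (\<Sum>i\<in>{1..n}. v i)"

definition face :: "nat \<Rightarrow> nat \<Rightarrow> nat \<Rightarrow> (nat \<Rightarrow> nat) \<Rightarrow> (nat \<Rightarrow> nat)" where
  "face n i j x = (\<lambda>l\<in>{1..n}. if l < i then x l else if l = i then j else x (l - 1))"

text \<open>
  The witness \<open>\<gamma>\<close> is the function \<open>\<gamma>\<^sub>\<phi>\<close>; it is determined by \<open>\<phi>\<close> on \<open>{1..m}\<close>, since the constant
  functions and the functions \<open>v \<mapsto> v j\<close>, \<open>v \<mapsto> 1 - v j\<close> for different \<open>j\<close> are pairwise distinct.
\<close>

definition cube_morphism :: "nat \<Rightarrow> nat \<Rightarrow> ((nat \<Rightarrow> nat) \<Rightarrow> (nat \<Rightarrow> nat)) \<Rightarrow> bool" where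
  "cube_morphism n m \<phi> \<longleftrightarrow>
     \<phi> \<in> cube n \<rightarrow>\<^sub>E cube m \<and>
     (\<exists>\<gamma> :: nat \<Rightarrow> nat.
        (\<forall>i\<in>{1..m}.
           (\<gamma> i = 0 \<and> (\<exists>b. \<forall>v\<in>cube n. \<phi> v i = b)) \<or>
           (\<gamma> i \<in> {1..n} \<and>
             ((\<forall>v\<in>cube n. \<phi> v i = v (\<gamma> i)) \<or> (\<forall>v\<in>cube n. \<phi> v i = 1 - v (\<gamma> i))))) \<and>
        (\<forall>i j. 1 \<le> i \<and> i < j \<and> j \<le> m \<longrightarrow> \<gamma> j = 0 \<or> \<gamma> i \<le> \<gamma> j))"


section \<open>Groupspaces\<close>

locale cube_structure =
  fixes X :: "'a set" and C :: "nat \<Rightarrow> ((nat \<Rightarrow> nat) \<Rightarrow> 'a) set"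
  assumes cubes_subset: "C n \<subseteq> cube n \<rightarrow>\<^sub>E X"
begin

text \<open>For \<open>n = 0\<close> the condition on the faces is vacuous, so \<open>C (n - 1)\<close> is only used for \<open>n \<ge> 1\<close>.\<close>

definition corner :: "nat \<Rightarrow> ((nat \<Rightarrow> nat) \<Rightarrow> 'a) \<Rightarrow> bool" where
  "corner n f \<longleftrightarrow>
     f \<in> punctured_cube n \<rightarrow>\<^sub>E X \<and>
     (\<forall>i\<in>{1..n}. compose (cube (n - 1)) f (face n i 0) \<in> C (n - 1))"

definition completion :: "nat \<Rightarrow> ((nat \<Rightarrow> nat) \<Rightarrow> 'a) \<Rightarrow> ((nat \<Rightarrow> nat) \<Rightarrow> 'a) \<Rightarrow> bool" where
  "completion n f \<phi> \<longleftrightarrow> \<phi> \<in> C n \<and> restrict \<phi> (punctured_cube n) = f"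

end

locale groupspace = cube_structure +
  assumes presheaf: "\<psi> \<in> C m \<Longrightarrow> cube_morphism n m \<phi> \<Longrightarrow> compose (cube n) \<psi> \<phi> \<in> C n"
    and ergodicity: "C 1 = (cube 1 \<rightarrow>\<^sub>E X)"
    and completion_exists: "corner n f \<Longrightarrow> \<exists>\<phi>. completion n f \<phi>"

locale k_step_groupspace = groupspace +
  fixes k :: nat
  assumes completion_unique: "corner (k + 1) f \<Longrightarrow> \<exists>!\<phi>. completion (k + 1) f \<phi>"


section \<open>The cube-structures \<open>\<D>\<^sub>1(G)\<close>, \<open>\<D>\<^sub>k(A)\<close> and \<open>\<H>\<^bsub>Z,k\<^esub>(G)\<close>\<close>

text \<open>The ordered product \<open>a\<^sub>0 a\<^sub>1\<^bsup>v\<^sub>1\<^esup> \<cdots> a\<^sub>n\<^bsup>v\<^sub>n\<^esup>\<close>.\<close>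

primrec ordered_product ::
  "('a, 'b) monoid_scheme \<Rightarrow> (nat \<Rightarrow> 'a) \<Rightarrow> (nat \<Rightarrow> nat) \<Rightarrow> nat \<Rightarrow> 'a" where
  "ordered_product G a v 0 = a 0"
| "ordered_product G a v (Suc n) = ordered_product G a v n \<otimes>\<^bsub>G\<^esub> (a (Suc n) [^]\<^bsub>G\<^esub> v (Suc n))"

definition D1_cubes :: "('a, 'b) monoid_scheme \<Rightarrow> nat \<Rightarrow> ((nat \<Rightarrow> nat) \<Rightarrow> 'a) set" where
  "D1_cubes G n =
     {g \<in> cube n \<rightarrow>\<^sub>E carrier G.
        \<exists>a \<in> {0..n} \<rightarrow> carrier G. \<forall>v\<in>cube n. g v = ordered_product G a v n}"

text \<open>
  The abelian group \<open>A\<close> is written multiplicatively, so that the alternating sum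
  \<open>\<Sum>\<^bsub>u \<le> v\<^esub> (-1)\<^bsup>h(u)\<^esup> f(u)\<close> becomes a \<^const>\<open>finprod\<close> of integer powers.
\<close>

definition Dk_cubes :: "('a, 'b) monoid_scheme \<Rightarrow> nat \<Rightarrow> nat \<Rightarrow> ((nat \<Rightarrow> nat) \<Rightarrow> 'a) set" where
  "Dk_cubes A k n =
     {f \<in> cube n \<rightarrow>\<^sub>E carrier A.
        \<forall>v\<in>cube n. k + 1 \<le> height n v \<longrightarrow>
          finprod A (\<lambda>u. f u [^]\<^bsub>A\<^esub> ((-1) ^ height n u :: int))
            {u \<in> cube n. \<forall>i\<in>{1..n}. u i \<le> v i} = \<one>\<^bsub>A\<^esub>}"

definition H_cubes ::
  "('a, 'b) monoid_scheme \<Rightarrow> 'a set \<Rightarrow> nat \<Rightarrow> nat \<Rightarrow> ((nat \<Rightarrow> nat) \<Rightarrow> 'a) set" where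
  "H_cubes G Z k n =
     {c \<in> cube n \<rightarrow>\<^sub>E carrier G.
        \<exists>f \<in> Dk_cubes (G\<lparr>carrier := Z\<rparr>) k n. \<exists>g \<in> D1_cubes G n.
          \<forall>x\<in>cube n. c x = f x \<otimes>\<^bsub>G\<^esub> g x}"

end

theory Submission
  imports Defs
begin

text \<open>
  Identify the vertices of a cube with subsets of \<open>{1..n}\<close>. The condition defining \<open>\<D>\<^sub>k\<close> says
  that a function on subsets has degree at most \<open>k\<close>: its alternating products over all subsets of
  larger size vanish. Such functions are stable under substitutions of coordinates, contain
  \<open>\<D>\<^sub>1(Z)\<close> because \<open>k \<ge> 1\<close>, and in dimension \<open>n > k\<close> the value at the top vertex is determined by the
  others. In \<open>\<D>\<^sub>1(G)\<close> constants can be moved to the left by conjugation, and the monotonicity of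
  \<open>\<gamma>\<close> keeps the factors in order. Two cubes of \<open>\<D>\<^sub>1(G)\<close> which agree modulo \<open>Z\<close> at the origin and
  at the unit vectors differ by a cube of \<open>\<D>\<^sub>1(Z)\<close>; this reduces completion and its uniqueness to
  \<open>\<D>\<^sub>k(Z)\<close>.
\<close>

section \<open>Functions of bounded degree on subsets\<close>

text \<open>A subset \<open>T\<close> stands for the vertex with support \<open>T\<close>:
  \<open>card T\<close> is its height and \<open>Pow S\<close> the set of vertices below the one of
  \<open>S\<close>. This is the alternating sum defining D_k, written multiplicatively.\<close>

definition alt_prod :: "('a, 'b) monoid_scheme \<Rightarrow> (nat set \<Rightarrow> 'a) \<Rightarrow> nat set \<Rightarrow> 'a" where
  "alt_prod A F S = finprod A (\<lambda>T. F T [^]\<^bsub>A\<^esub> ((-1) ^ card T :: int)) (Pow S)"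

text \<open>The bound is strict, so D_k corresponds to \<open>k + 1\<close>. On finite
  \<open>N\<close> the value \<open>d = 0\<close> leaves only the trivial function, which gives the
  truncated \<open>d - 1\<close> used below the right meaning.\<close>

definition degree_less ::
  "('a, 'b) monoid_scheme \<Rightarrow> nat \<Rightarrow> nat set \<Rightarrow> (nat set \<Rightarrow> 'a) \<Rightarrow> bool" where
  "degree_less A d N F \<longleftrightarrow> F \<in> Pow N \<rightarrow> carrier A \<and>
     (\<forall>S\<subseteq>N. d \<le> card S \<longrightarrow> alt_prod A F S = \<one>\<^bsub>A\<^esub>)"

context comm_group
begin

section \<open>Calculus of alternating products\<close>

lemma alt_prod_closed [simp]: "F \<in> Pow S \<rightarrow> carrier G \<Longrightarrow> alt_prod G F S \<in> carrier G"
  unfolding alt_prod_def by (intro finprod_closed) auto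

lemma alt_prod_cong:
  assumes "\<And>T. T \<subseteq> S \<Longrightarrow> F T = H T" "H \<in> Pow S \<rightarrow> carrier G"
  shows "alt_prod G F S = alt_prod G H S"
  unfolding alt_prod_def using assms by (intro finprod_cong') auto

lemma alt_prod_one: "alt_prod G (\<lambda>_. \<one>) S = \<one>"
  unfolding alt_prod_def by (intro finprod_one_eqI) auto

lemma alt_prod_mult:
  assumes "F \<in> Pow S \<rightarrow> carrier G" "H \<in> Pow S \<rightarrow> carrier G"
  shows "alt_prod G (\<lambda>T. F T \<otimes> H T) S = alt_prod G F S \<otimes> alt_prod G H S"
proof -
  have "alt_prod G (\<lambda>T. F T \<otimes> H T) S = (\<Otimes>T\<in>Pow S. F T [^] ((-1) ^ card T :: int)
      \<otimes> H T [^] ((-1) ^ card T :: int))"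
    unfolding alt_prod_def using assms
    by (intro finprod_cong') (auto simp: int_pow_distrib Pi_iff)
  also have "\<dots> = alt_prod G F S \<otimes> alt_prod G H S"
    unfolding alt_prod_def using assms by (intro finprod_multf) (auto simp: Pi_iff)
  finally show ?thesis .
qed

lemma alt_prod_inv:
  assumes "F \<in> Pow S \<rightarrow> carrier G"
  shows "alt_prod G (\<lambda>T. inv (F T)) S = inv (alt_prod G F S)"
proof -
  have i: "(\<lambda>T. inv (F T)) \<in> Pow S \<rightarrow> carrier G" using assms by auto
  have "alt_prod G (\<lambda>T. inv (F T)) S \<otimes> alt_prod G F S = alt_prod G (\<lambda>T. inv (F T) \<otimes> F T) S"
    using alt_prod_mult[OF i assms] by simp
  also have "\<dots> = alt_prod G (\<lambda>_. \<one>) S"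
    using assms by (intro alt_prod_cong) (auto simp: Pi_iff)
  finally show ?thesis
    using i assms by (simp add: alt_prod_one inv_equality)
qed

text \<open>The subsets of \<open>insert j S\<close> come in pairs \<open>T\<close>,
  \<open>insert j T\<close> with opposite signs.\<close>

lemma alt_prod_insert:
  assumes "finite S" "j \<notin> S" "F \<in> Pow (insert j S) \<rightarrow> carrier G"
  shows "alt_prod G F (insert j S) = alt_prod G F S \<otimes> inv (alt_prod G (\<lambda>T. F (insert j T)) S)"
proof -
  let ?p = "\<lambda>T. F T [^] ((-1) ^ card T :: int)"
  have c: "?p \<in> Pow (insert j S) \<rightarrow> carrier G" using assms(3) by auto
  have inj: "inj_on (insert j) (Pow S)"
    using assms(2) by (auto simp: inj_on_def)
  have "alt_prod G F (insert j S) = finprod G ?p (Pow S) \<otimes> finprod G ?p (insert j ` Pow S)"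
    unfolding alt_prod_def Pow_insert
    using assms(1,2) c by (intro finprod_Un_disjoint) (auto simp: Pow_insert)
  also have "finprod G ?p (insert j ` Pow S) = finprod G (\<lambda>T. ?p (insert j T)) (Pow S)"
    using c inj by (intro finprod_reindex) (auto simp: Pow_insert)
  also have "\<dots> = alt_prod G (\<lambda>T. inv (F (insert j T))) S"
    unfolding alt_prod_def
  proof (intro finprod_cong')
    show "(\<lambda>T. inv F (insert j T) [^] ((-1) ^ card T :: int)) \<in> Pow S \<rightarrow> carrier G"
      using assms(3) by auto
  next
    fix T assume T: "T \<in> Pow S"
    then have "finite T" "j \<notin> T" using assms(1,2) finite_subset by auto
    moreover have "F (insert j T) \<in> carrier G" using T assms(3) by auto
    ultimately show "?p (insert j T) = inv F (insert j T) [^] ((-1) ^ card T :: int)"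
      by (simp add: int_pow_neg int_pow_inv)
  qed simp
  also have "\<dots> = inv (alt_prod G (\<lambda>T. F (insert j T)) S)"
    using assms(3) by (intro alt_prod_inv) auto
  finally show ?thesis by (simp add: alt_prod_def)
qed

lemma alt_prod_supported_at_top:
  assumes "finite S" "F \<in> Pow S \<rightarrow> carrier G" "\<And>T. T \<subset> S \<Longrightarrow> F T = \<one>"
  shows "alt_prod G F S = F S [^] ((-1) ^ card S :: int)"
proof -
  let ?p = "\<lambda>T. F T [^] ((-1) ^ card T :: int)"
  have "alt_prod G F S = (\<Otimes>T\<in>Pow S. if S = T then ?p T else \<one>)"
    unfolding alt_prod_def using assms
    by (intro finprod_cong') (auto simp: psubset_eq Pi_iff)
  also have "\<dots> = ?p S"
    using assms by (intro finprod_singleton) auto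
  finally show ?thesis .
qed

section \<open>Operations on functions of bounded degree\<close>

lemma degree_less_closed: "degree_less G d N F \<Longrightarrow> T \<subseteq> N \<Longrightarrow> F T \<in> carrier G"
  by (auto simp: degree_less_def)

lemma degree_less_funcset: "degree_less G d N F \<Longrightarrow> S \<subseteq> N \<Longrightarrow> F \<in> Pow S \<rightarrow> carrier G"
  by (auto simp: degree_less_closed)

lemma degree_less_cong:
  assumes "degree_less G d N F" "\<And>T. T \<subseteq> N \<Longrightarrow> H T = F T"
  shows "degree_less G d N H"
proof -
  have "alt_prod G H S = alt_prod G F S" if "S \<subseteq> N" for S
    using assms that by (intro alt_prod_cong degree_less_funcset[of d N F]) auto
  then show ?thesis using assms by (auto simp: degree_less_def)
qed

lemma degree_less_mono: "degree_less G d N F \<Longrightarrow> d \<le> e \<Longrightarrow> degree_less G e N F"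
  by (auto simp: degree_less_def)

lemma degree_less_subset: "degree_less G d N F \<Longrightarrow> M \<subseteq> N \<Longrightarrow> degree_less G d M F"
  using degree_less_funcset[of d N F M] by (auto simp: degree_less_def)

lemma degree_less_mult:
  assumes "degree_less G d N F" "degree_less G d N H"
  shows "degree_less G d N (\<lambda>T. F T \<otimes> H T)"
proof -
  have "alt_prod G (\<lambda>T. F T \<otimes> H T) S = alt_prod G F S \<otimes> alt_prod G H S" if "S \<subseteq> N" for S
    using assms that by (intro alt_prod_mult degree_less_funcset[of d N]) auto
  then show ?thesis using assms by (auto simp: degree_less_def)
qed

lemma degree_less_inv:
  assumes "degree_less G d N F"
  shows "degree_less G d N (\<lambda>T. inv (F T))"
proof -
  have "alt_prod G (\<lambda>T. inv (F T)) S = inv (alt_prod G F S)" if "S \<subseteq> N" for S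
    using assms that by (intro alt_prod_inv degree_less_funcset[of d N]) auto
  then show ?thesis using assms by (auto simp: degree_less_def)
qed

text \<open>A nonempty \<open>S\<close> splits as \<open>insert j S'\<close>, and the two halves
  given by \<open>alt_prod_insert\<close> cancel.\<close>

lemma degree_less_const:
  assumes "finite N" "c \<in> carrier G"
  shows "degree_less G 1 N (\<lambda>_. c)"
proof -
  have "alt_prod G (\<lambda>_. c) S = \<one>" if S: "S \<subseteq> N" "1 \<le> card S" for S
  proof -
    have "finite S" using S assms(1) finite_subset by blast
    moreover obtain j S' where "S = insert j S'" "j \<notin> S'"
      using S(2) by (metis card.empty ex_in_conv mk_disjoint_insert not_one_le_zero)
    ultimately show ?thesis
      using assms(2) by (simp add: alt_prod_insert)
  qed
  then show ?thesis using assms by (auto simp: degree_less_def)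
qed

text \<open>For \<open>S = insert j R\<close> only the sets containing \<open>j\<close> contribute.
  Up to inversion their contribution is the quotient of the alternating products of \<open>F\<close>
  over \<open>R\<close> and over \<open>S\<close>, and both are trivial because \<open>R\<close>
  still has at least \<open>d - 1\<close> elements.\<close>

lemma degree_less_indicator:
  assumes N: "finite N" and F: "degree_less G (d - 1) N F"
  shows "degree_less G d N (\<lambda>T. if j \<in> T then F T else \<one>)" (is "degree_less G d N ?H")
proof -
  have H: "?H \<in> Pow N \<rightarrow> carrier G" using F by (auto simp: degree_less_def)
  have "alt_prod G ?H S = \<one>" if S: "S \<subseteq> N" "d \<le> card S" for S
  proof (cases "j \<in> S")
    case False
    then have "alt_prod G ?H S = alt_prod G (\<lambda>_. \<one>) S" by (intro alt_prod_cong) auto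
    then show ?thesis by (simp add: alt_prod_one)
  next
    case True
    then obtain R where R: "S = insert j R" "j \<notin> R" by (metis mk_disjoint_insert)
    have fin: "finite R" using finite_subset[OF S(1) N] R(1) by simp
    have sub: "S \<subseteq> N" "R \<subseteq> N" using S R by auto
    have Fc: "F \<in> Pow S \<rightarrow> carrier G" "F \<in> Pow R \<rightarrow> carrier G"
      by (rule degree_less_funcset[OF F sub(1)] degree_less_funcset[OF F sub(2)])+
    have ic: "(\<lambda>T. F (insert j T)) \<in> Pow R \<rightarrow> carrier G"
      using R S by (auto intro!: degree_less_closed[OF F])
    have "d \<le> Suc (card R)" using S(2) R fin by simp
    then have "alt_prod G F S = \<one>" "alt_prod G F R = \<one>"
      using F S(2) sub by (auto simp: degree_less_def)
    moreover have "alt_prod G F S = alt_prod G F R \<otimes> inv (alt_prod G (\<lambda>T. F (insert j T)) R)"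
      using alt_prod_insert[OF fin R(2)] Fc R(1) by simp
    ultimately have "inv (alt_prod G (\<lambda>T. F (insert j T)) R) = \<one>"
      using ic by simp
    then have "alt_prod G (\<lambda>T. F (insert j T)) R = \<one>"
      using ic by (simp add: inv_eq_1_iff)
    moreover have "alt_prod G ?H R = alt_prod G (\<lambda>_. \<one>) R"
      using R by (intro alt_prod_cong) auto
    moreover have "alt_prod G ?H S = alt_prod G ?H R \<otimes> inv (alt_prod G (\<lambda>T. ?H (insert j T)) R)"
      using alt_prod_insert[OF fin R(2), of ?H] H S R(1) by auto
    ultimately show ?thesis by (simp add: alt_prod_one)
  qed
  then show ?thesis using H by (auto simp: degree_less_def)
qed

text \<open>By \<open>alt_prod_insert\<close> the alternating product over \<open>S\<close> is the
  inverse of that of \<open>F\<close> over \<open>insert i S\<close>, a set with one element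
  more.\<close>

lemma degree_less_derivative:
  assumes M: "finite M" "i \<notin> M" and F: "degree_less G d (insert i M) F"
  shows "degree_less G (d - 1) M (\<lambda>T. F (insert i T) \<otimes> inv (F T))"
proof -
  have "alt_prod G (\<lambda>T. F (insert i T) \<otimes> inv (F T)) S = \<one>" if S: "S \<subseteq> M" "d - 1 \<le> card S" for S
  proof -
    have fin: "finite S" "i \<notin> S" using S M finite_subset by auto
    have c: "F \<in> Pow S \<rightarrow> carrier G" "(\<lambda>T. F (insert i T)) \<in> Pow S \<rightarrow> carrier G"
      "F \<in> Pow (insert i S) \<rightarrow> carrier G"
      using S by (auto intro!: degree_less_closed[OF F])
    have "alt_prod G (\<lambda>T. F (insert i T) \<otimes> inv (F T)) S
        = alt_prod G (\<lambda>T. F (insert i T)) S \<otimes> inv (alt_prod G F S)"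
      using c by (subst alt_prod_mult) (auto simp: alt_prod_inv)
    also have "\<dots> = inv (alt_prod G F (insert i S))"
      using alt_prod_insert[OF fin c(3)] c by (simp add: inv_mult_group)
    also have "alt_prod G F (insert i S) = \<one>"
      using F S fin insert_mono[OF S(1), of i] by (auto simp: degree_less_def)
    finally show ?thesis by simp
  qed
  moreover have "(\<lambda>T. F (insert i T) \<otimes> inv (F T)) \<in> Pow M \<rightarrow> carrier G"
    by (intro funcsetI m_closed inv_closed degree_less_closed[OF F]) auto
  ultimately show ?thesis by (simp add: degree_less_def)
qed

text \<open>Splitting off the coordinate \<open>i\<close> writes \<open>F\<close> as \<open>F\<^sub>0 \<cdot> D\<^bsup>v\<^sub>i\<^esup>\<close> with the discrete derivative
  \<open>D\<close>, whose degree is smaller by one; substituting \<open>v\<^sub>j\<close> or \<open>1 - v\<^sub>j\<close> for \<open>v\<^sub>i\<close> raises it by at most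
  one again.\<close>

lemma degree_less_comp:
  assumes "finite M" "finite N" "degree_less G d M F"
    and "\<And>T. T \<subseteq> N \<Longrightarrow> \<Phi> T \<subseteq> M"
    and "\<And>i. i \<in> M \<Longrightarrow> (\<exists>b. \<forall>T\<subseteq>N. (i \<in> \<Phi> T) = b) \<or>
      (\<exists>j\<in>N. (\<forall>T\<subseteq>N. i \<in> \<Phi> T \<longleftrightarrow> j \<in> T) \<or> (\<forall>T\<subseteq>N. i \<in> \<Phi> T \<longleftrightarrow> j \<notin> T))"
  shows "degree_less G d N (\<lambda>T. F (\<Phi> T))"
  using assms
proof (induction M arbitrary: d F \<Phi> rule: finite_induct)
  case empty
  have "degree_less G d N (\<lambda>_. F {})"
  \<comment> \<open>A nontrivial constant has degree less than \<open>d\<close> only for positive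
    \<open>d\<close>; for \<open>d = 0\<close> the assumption on \<open>F\<close> at the empty set
    forces the constant to be \<open>\<one>\<close>.\<close>
  proof (cases "d = 0")
    case True
    then have "alt_prod G F {} = \<one>" using empty by (auto simp: degree_less_def)
    moreover have "F {} \<in> carrier G" using empty by (auto simp: degree_less_def)
    ultimately have "F {} = \<one>" using alt_prod_supported_at_top[of "{}" F] by simp
    then show ?thesis by (simp add: degree_less_def alt_prod_one)
  next
    case False
    have "F {} \<in> carrier G" using empty by (auto simp: degree_less_def)
    then show ?thesis
      using False degree_less_mono[OF degree_less_const[of N "F {}"], of d] empty by simp
  qed
  then show ?case
    using empty(3) by (elim degree_less_cong) auto
next
  case (insert i M)
  \<comment> \<open>Deleting \<open>i\<close> makes \<open>\<Phi>'\<close> land in the subsets of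
    \<open>M\<close>, where the induction hypothesis applies both to \<open>F\<close> and to its
    derivative \<open>D\<close>.\<close>
  define \<Phi>' where "\<Phi>' T = \<Phi> T - {i}" for T
  define D where "D T = F (insert i T) \<otimes> inv (F T)" for T
  have \<Phi>'M: "\<Phi>' T \<subseteq> M" if "T \<subseteq> N" for T
    using insert.prems(3)[OF that] by (auto simp: \<Phi>'_def)
  have \<Phi>'c: "(\<exists>b. \<forall>T\<subseteq>N. (l \<in> \<Phi>' T) = b) \<or>
      (\<exists>j\<in>N. (\<forall>T\<subseteq>N. l \<in> \<Phi>' T \<longleftrightarrow> j \<in> T) \<or> (\<forall>T\<subseteq>N. l \<in> \<Phi>' T \<longleftrightarrow> j \<notin> T))"
    if "l \<in> M" for l
  proof -
    have "l \<in> \<Phi>' T \<longleftrightarrow> l \<in> \<Phi> T" for T using that insert.hyps by (auto simp: \<Phi>'_def)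
    then show ?thesis using insert.prems(4)[of l] that by simp
  qed
  have F0: "degree_less G d N (\<lambda>T. F (\<Phi>' T))"
    using insert.prems(1) degree_less_subset[OF insert.prems(2)] \<Phi>'M \<Phi>'c
    by (intro insert.IH) auto
  have D: "degree_less G (d - 1) N (\<lambda>T. D (\<Phi>' T))"
    using insert.prems(1) degree_less_derivative[OF insert.hyps insert.prems(2)] \<Phi>'M \<Phi>'c
    unfolding D_def by (intro insert.IH) auto
  have Dd: "degree_less G d N (\<lambda>T. D (\<Phi>' T))"
    using D by (rule degree_less_mono) simp
  have Dj: "degree_less G d N (\<lambda>T. if j \<in> T then D (\<Phi>' T) else \<one>)" for j
    using degree_less_indicator[OF insert.prems(1) D] .
  have one: "degree_less G d N (\<lambda>T. \<one>)"
    by (simp add: degree_less_def alt_prod_one)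
  have "degree_less G d N (\<lambda>T. if i \<in> \<Phi> T then D (\<Phi>' T) else \<one>)"
    using insert.prems(4)[OF insertI1]
  proof (elim disjE bexE exE)
    fix b assume "\<forall>T\<subseteq>N. (i \<in> \<Phi> T) = b"
    then show ?thesis
      by (cases b) (auto intro: degree_less_cong[OF Dd] degree_less_cong[OF one])
  next
    fix j assume "\<forall>T\<subseteq>N. i \<in> \<Phi> T \<longleftrightarrow> j \<in> T"
    then show ?thesis by (intro degree_less_cong[OF Dj[of j]]) auto
  next
    fix j assume j: "\<forall>T\<subseteq>N. i \<in> \<Phi> T \<longleftrightarrow> j \<notin> T"
    \<comment> \<open>The factor present for \<open>j \<notin> T\<close> is the full factor divided
      by the one present for \<open>j \<in> T\<close>.\<close>
    show ?thesis
      by (rule degree_less_cong[OF degree_less_mult[OF Dd degree_less_inv[OF Dj[of j]]]])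
        (use j degree_less_closed[OF Dd] in auto)
  qed
  then have "degree_less G d N (\<lambda>T. (if i \<in> \<Phi> T then D (\<Phi>' T) else \<one>) \<otimes> F (\<Phi>' T))"
    using F0 by (rule degree_less_mult)
  then show ?case
  proof (rule degree_less_cong)
    fix T assume T: "T \<subseteq> N"
    have c: "F (\<Phi>' T) \<in> carrier G" using degree_less_closed[OF F0 T] .
    have e: "F (\<Phi> T) \<in> carrier G"
      using degree_less_closed[OF insert.prems(2)] insert.prems(3)[OF T] by blast
    show "F (\<Phi> T) = (if i \<in> \<Phi> T then D (\<Phi>' T) else \<one>) \<otimes> F (\<Phi>' T)"
    proof (cases "i \<in> \<Phi> T")
      case True
      then have "insert i (\<Phi>' T) = \<Phi> T" by (auto simp: \<Phi>'_def)
      then show ?thesis using True c e by (simp add: D_def m_assoc)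
    next
      case False
      then have "\<Phi>' T = \<Phi> T" by (auto simp: \<Phi>'_def)
      then show ?thesis using False e by simp
    qed
  qed
qed

section \<open>The value at the top vertex\<close>

text \<open>In the alternating product over \<open>N\<close> only \<open>F N\<close> is left, with
  exponent 1 or -1.\<close>

lemma degree_less_eq_oneI:
  assumes "finite N" "degree_less G d N F" "d \<le> card N" "\<And>T. T \<subset> N \<Longrightarrow> F T = \<one>"
  shows "F N = \<one>"
proof -
  have c: "F N \<in> carrier G" "F \<in> Pow N \<rightarrow> carrier G" using assms(2) by (auto simp: degree_less_def)
  have "F N [^] ((-1) ^ card N :: int) = \<one>"
    using alt_prod_supported_at_top[OF assms(1) c(2) assms(4)] assms(2,3)
    by (auto simp: degree_less_def)
  \<comment> \<open>A sign squares to one, so taking this power twice returns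
    \<open>F N\<close>.\<close>
  then have "(F N [^] ((-1) ^ card N :: int)) [^] ((-1) ^ card N :: int) = \<one>" by simp
  then show ?thesis
    using c by (simp add: int_pow_pow flip: power_mult_distrib)
qed

text \<open>A proper subset of \<open>N\<close> avoids some \<open>i\<close> and is covered by the
  face of \<open>i\<close>. The product over \<open>N\<close> itself contains the top value with
  exponent 1 or -1, so correcting this single value makes it trivial.\<close>

lemma degree_less_completion:
  assumes N: "finite N" and F: "F \<in> Pow N \<rightarrow> carrier G"
    and faces: "\<And>i. i \<in> N \<Longrightarrow> degree_less G d (N - {i}) F"
  obtains c where "c \<in> carrier G" "degree_less G d N (F(N := c))"
proof -
  define e :: int where "e = (-1) ^ card N"
  \<comment> \<open>Since \<open>e\<close> is a sign, \<open>w [^] e\<close> is the inverse of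
    \<open>alt_prod G F N\<close>, which is the missing factor.\<close>
  define w where "w = alt_prod G F N [^] (- e)"
  have ee: "e * e = 1" by (simp add: e_def flip: power_mult_distrib)
  have w: "w \<in> carrier G" using F by (simp add: w_def)
  define \<delta> where "\<delta> T = (if T = N then w else \<one>)" for T
  have \<delta>: "\<delta> \<in> Pow N \<rightarrow> carrier G" using w by (simp add: \<delta>_def)
  define c where "c = F N \<otimes> w"
  have FN: "F N \<in> carrier G" using F by auto
  have c: "c \<in> carrier G" using FN w by (simp add: c_def)
  have Fc: "F(N := c) \<in> Pow N \<rightarrow> carrier G" using F c by auto
  have "alt_prod G (F(N := c)) S = \<one>" if S: "S \<subseteq> N" "d \<le> card S" for S
  proof (cases "S = N")
    case True
    have "alt_prod G (F(N := c)) N = alt_prod G (\<lambda>T. F T \<otimes> \<delta> T) N"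
      using F w by (intro alt_prod_cong) (auto simp: \<delta>_def c_def Pi_iff)
    also have "\<dots> = alt_prod G F N \<otimes> alt_prod G \<delta> N"
      by (rule alt_prod_mult[OF F \<delta>])
    also have "alt_prod G \<delta> N = w [^] e"
      using alt_prod_supported_at_top[OF N \<delta>] by (simp add: psubset_eq \<delta>_def e_def)
    also have "\<dots> = alt_prod G F N [^] (- e * e)"
      unfolding w_def using F by (intro int_pow_pow) simp
    also have "\<dots> = inv (alt_prod G F N)"
      using F by (simp add: ee int_pow_neg)
    also have "alt_prod G F N \<otimes> \<dots> = \<one>" using F by simp
    finally show ?thesis unfolding True .
  next
    case False
    then obtain i where i: "i \<in> N" "S \<subseteq> N - {i}" using S by blast
    have "alt_prod G (F(N := c)) S = alt_prod G F S"
      using False S F by (intro alt_prod_cong) auto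
    then show ?thesis using faces[OF i(1)] i S by (simp add: degree_less_def)
  qed
  then have "degree_less G d N (F(N := c))" using Fc by (simp add: degree_less_def)
  with c show thesis by (rule that)
qed

end


section \<open>The cubes of \<open>\<D>\<^sub>k\<close>\<close>

text \<open>The dictionary between subsets and vertices; taking the support is its inverse, see
  \<open>vertex_support\<close> and \<open>vertex_inject\<close>.\<close>

definition vertex :: "nat \<Rightarrow> nat set \<Rightarrow> nat \<Rightarrow> nat" where
  "vertex n T = (\<lambda>i\<in>{1..n}. if i \<in> T then 1 else 0)"

section \<open>Vertices as subsets\<close>

lemma vertex_in_cube [simp]: "vertex n T \<in> cube n"
  by (auto simp: vertex_def cube_def)

lemma vertex_apply: "i \<in> {1..n} \<Longrightarrow> vertex n T i = (if i \<in> T then 1 else 0)"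
  by (simp only: vertex_def restrict_apply if_True)

lemma vertex_eq_0_iff [simp]: "i \<in> {1..n} \<Longrightarrow> vertex n T i = 0 \<longleftrightarrow> i \<notin> T"
  by (simp only: vertex_apply split: if_split) simp

lemma vertex_eq_1_iff [simp]: "i \<in> {1..n} \<Longrightarrow> vertex n T i = Suc 0 \<longleftrightarrow> i \<in> T"
  by (simp only: vertex_apply split: if_split) simp

lemma cube_values: "x \<in> cube n \<Longrightarrow> i \<in> {1..n} \<Longrightarrow> x i = 0 \<or> x i = 1"
  unfolding cube_def by (blast dest: PiE_mem)

lemma cube_eqI:
  assumes "x \<in> cube n" "y \<in> cube n" "\<And>i. i \<in> {1..n} \<Longrightarrow> x i = 1 \<longleftrightarrow> y i = 1"
  shows "x = y"
proof (rule PiE_ext)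
  show "x \<in> {1..n} \<rightarrow>\<^sub>E {0, 1}" "y \<in> {1..n} \<rightarrow>\<^sub>E {0, 1}" using assms(1,2) by (simp_all only: cube_def)
  show "x i = y i" if "i \<in> {1..n}" for i
    using cube_values[OF assms(1) that] cube_values[OF assms(2) that] assms(3)[OF that] by metis
qed

lemma vertex_support: "x \<in> cube n \<Longrightarrow> vertex n {i \<in> {1..n}. x i = 1} = x"
  by (rule cube_eqI) auto

lemma cubeE:
  assumes "x \<in> cube n"
  obtains T where "T \<subseteq> {1..n}" "x = vertex n T"
  using vertex_support[OF assms] by (metis (no_types, lifting) mem_Collect_eq subsetI)

lemma vertex_inject:
  assumes "S \<subseteq> {1..n}" "T \<subseteq> {1..n}" "vertex n S = vertex n T"
  shows "S = T"
proof -
  have "i \<in> S \<longleftrightarrow> i \<in> T" if "i \<in> {1..n}" for i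
    using assms(3) vertex_eq_0_iff[OF that] by metis
  then show ?thesis using assms(1,2) by blast
qed

lemma ones_eq_vertex: "ones n = vertex n {1..n}"
  by (auto simp: ones_def vertex_def)

lemma ones_in_cube [simp]: "ones n \<in> cube n"
  by (simp add: ones_eq_vertex)

text \<open>Used to cover a corner by its faces: each point where it is defined lies on some face
  \<open>x i = 0\<close>.\<close>

lemma punctured_cube_iff: "x \<in> punctured_cube n \<longleftrightarrow> x \<in> cube n \<and> (\<exists>i\<in>{1..n}. x i = 0)"
proof (cases "x \<in> cube n")
  case True
  have "x = ones n \<longleftrightarrow> (\<forall>i\<in>{1..n}. x i = 1)"
    using cube_eqI[OF True ones_in_cube] by (auto simp: ones_def)
  also have "\<dots> \<longleftrightarrow> \<not> (\<exists>i\<in>{1..n}. x i = 0)"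
    using cube_values[OF True] by (metis zero_neq_one)
  finally show ?thesis using True by (simp add: punctured_cube_def)
qed (simp add: punctured_cube_def)

lemma height_vertex: "T \<subseteq> {1..n} \<Longrightarrow> height n (vertex n T) = card T"
proof -
  assume T: "T \<subseteq> {1..n}"
  have "height n (vertex n T) = (\<Sum>i\<in>{1..n}. if i \<in> T then 1 else 0)"
    unfolding height_def by (intro sum.cong) (simp_all only: vertex_apply)
  also have "\<dots> = card T" using T by (simp add: sum.If_cases Int_absorb1)
  finally show ?thesis .
qed

lemma lower_vertices:
  assumes "S \<subseteq> {1..n}"
  shows "{u \<in> cube n. \<forall>i\<in>{1..n}. u i \<le> vertex n S i} = vertex n ` Pow S"
proof (intro equalityI subsetI)
  fix u assume u: "u \<in> {u \<in> cube n. \<forall>i\<in>{1..n}. u i \<le> vertex n S i}"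
  then obtain T where T: "T \<subseteq> {1..n}" "u = vertex n T" using cubeE by blast
  have "i \<in> S" if "i \<in> T" for i
  proof -
    have i: "i \<in> {1..n}" using that T by blast
    then have "vertex n T i \<le> vertex n S i" using u T by blast
    then show ?thesis using i that by (metis vertex_eq_0_iff le_zero_eq)
  qed
  then show "u \<in> vertex n ` Pow S" using T by blast
next
  fix u assume "u \<in> vertex n ` Pow S"
  then show "u \<in> {u \<in> cube n. \<forall>i\<in>{1..n}. u i \<le> vertex n S i}"
    by (auto simp: vertex_apply)
qed

lemma cube_morphism_closed: "cube_morphism n m \<phi> \<Longrightarrow> v \<in> cube n \<Longrightarrow> \<phi> v \<in> cube m"
  unfolding cube_morphism_def by (blast dest: PiE_mem)

lemma cube_morphismE:
  assumes "cube_morphism n m \<phi>" "i \<in> {1..m}"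
  obtains b where "\<And>v. v \<in> cube n \<Longrightarrow> \<phi> v i = b"
  | j where "j \<in> {1..n}" "\<And>v. v \<in> cube n \<Longrightarrow> \<phi> v i = v j"
  | j where "j \<in> {1..n}" "\<And>v. v \<in> cube n \<Longrightarrow> \<phi> v i = 1 - v j"
  using assms unfolding cube_morphism_def by metis

context comm_group
begin

section \<open>The cube-structure D_k through bounded degree\<close>

text \<open>Reindexing along \<open>vertex n\<close> turns the vertices below a given one into
  \<open>Pow S\<close> and the height into the cardinality.\<close>

lemma Dk_cubes_iff:
  "f \<in> Dk_cubes G k n \<longleftrightarrow>
     f \<in> extensional (cube n) \<and> degree_less G (k + 1) {1..n} (\<lambda>T. f (vertex n T))"
proof -
  have *: "f \<in> cube n \<rightarrow> carrier G \<longleftrightarrow> (\<lambda>T. f (vertex n T)) \<in> Pow {1..n} \<rightarrow> carrier G"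
    by (auto elim!: cubeE)
  have "finprod G (\<lambda>u. f u [^] ((-1) ^ height n u :: int))
      {u \<in> cube n. \<forall>i\<in>{1..n}. u i \<le> vertex n S i} = alt_prod G (\<lambda>T. f (vertex n T)) S"
    if S: "S \<subseteq> {1..n}" and f: "f \<in> cube n \<rightarrow> carrier G" for S
  proof -
    have c: "(\<lambda>u. f u [^] ((-1) ^ height n u :: int)) \<in> vertex n ` Pow S \<rightarrow> carrier G"
      using f by auto
    have inj: "inj_on (vertex n) (Pow S)"
      using S vertex_inject by (meson PowD inj_onI subset_trans)
    show ?thesis
      unfolding lower_vertices[OF S] finprod_reindex[OF c inj] alt_prod_def
    proof (rule finprod_cong')
      show "(\<lambda>T. f (vertex n T) [^] ((-1) ^ card T :: int)) \<in> Pow S \<rightarrow> carrier G"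
        using f by auto
      show "f (vertex n T) [^] ((-1) ^ height n (vertex n T) :: int)
          = f (vertex n T) [^] ((-1) ^ card T :: int)" if "T \<in> Pow S" for T
        using height_vertex[of T n] that S by simp
    qed simp
  qed
  note alt_eq = this
  have "(\<forall>v\<in>cube n. k + 1 \<le> height n v \<longrightarrow>
        finprod G (\<lambda>u. f u [^] ((-1) ^ height n u :: int))
            {u \<in> cube n. \<forall>i\<in>{1..n}. u i \<le> v i} = \<one>) \<longleftrightarrow>
      (\<forall>S\<subseteq>{1..n}. k + 1 \<le> card S \<longrightarrow> alt_prod G (\<lambda>T. f (vertex n T)) S = \<one>)"
    (is "(\<forall>v\<in>cube n. ?P v) \<longleftrightarrow> (\<forall>S\<subseteq>{1..n}. ?Q S)") if "f \<in> cube n \<rightarrow> carrier G"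
  proof -
    have "?P (vertex n S) \<longleftrightarrow> ?Q S" if "S \<subseteq> {1..n}" for S
      using alt_eq[OF that \<open>f \<in> cube n \<rightarrow> carrier G\<close>] that by (simp only: height_vertex)
    note PQ = this
    show ?thesis
    proof (intro iffI allI ballI)
      fix S assume "\<forall>v\<in>cube n. ?P v"
      then have "?P (vertex n S)" using vertex_in_cube by blast
      then show "S \<subseteq> {1..n} \<longrightarrow> ?Q S" using PQ by blast
    next
      fix v assume *: "\<forall>S\<subseteq>{1..n}. ?Q S" and "v \<in> cube n"
      then obtain S where "S \<subseteq> {1..n}" "v = vertex n S" by (elim cubeE)
      then show "?P v" using PQ * by simp
    qed
  qed
  then show ?thesis
    unfolding Dk_cubes_def degree_less_def PiE_def using * by auto
qed

lemma Dk_cubesI: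
  assumes "degree_less G (k + 1) {1..n} F" "\<And>T. T \<subseteq> {1..n} \<Longrightarrow> f (vertex n T) = F T"
  shows "(\<lambda>x\<in>cube n. f x) \<in> Dk_cubes G k n"
  unfolding Dk_cubes_iff using assms by (auto intro: degree_less_cong)

lemma Dk_cubes_degree_less:
  "f \<in> Dk_cubes G k n \<Longrightarrow> degree_less G (k + 1) {1..n} (\<lambda>T. f (vertex n T))"
  by (simp add: Dk_cubes_iff)

lemma Dk_cubes_mult:
  assumes "f \<in> Dk_cubes G k n" "g \<in> Dk_cubes G k n"
  shows "(\<lambda>x\<in>cube n. f x \<otimes> g x) \<in> Dk_cubes G k n"
  by (rule Dk_cubesI[OF degree_less_mult[OF assms[THEN Dk_cubes_degree_less]]]) simp

lemma Dk_cubes_inv: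
  assumes "f \<in> Dk_cubes G k n"
  shows "(\<lambda>x\<in>cube n. inv (f x)) \<in> Dk_cubes G k n"
  by (rule Dk_cubesI[OF degree_less_inv[OF Dk_cubes_degree_less[OF assms]]]) simp

text \<open>Each factor is a constant switched on by one coordinate, hence of degree at most 1, and
  so is the product. The hypothesis \<open>k \<ge> 1\<close> enters as
  \<open>2 \<le> k + 1\<close>.\<close>

lemma Dk_cubes_ordered_product:
  assumes "k \<ge> 1" "\<And>t. a t \<in> carrier G"
  shows "(\<lambda>x\<in>cube n. ordered_product G a x n) \<in> Dk_cubes G k n"
proof (rule Dk_cubesI)
  have "degree_less G 2 {1..n} (\<lambda>T. ordered_product G a (vertex n T) m)" if "m \<le> n" for m
    using that
  proof (induction m)
    case 0
    show ?case using degree_less_mono[OF degree_less_const] assms by simp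
  next
    case (Suc m)
    have "degree_less G (2 - 1) {1..n} (\<lambda>_. a (Suc m))"
      using degree_less_const assms by simp
    then have "degree_less G 2 {1..n} (\<lambda>T. if Suc m \<in> T then a (Suc m) else \<one>)"
      by (rule degree_less_indicator[rotated]) simp
    then have "degree_less G 2 {1..n} (\<lambda>T. ordered_product G a (vertex n T) m \<otimes>
        (if Suc m \<in> T then a (Suc m) else \<one>))"
      using Suc by (intro degree_less_mult) auto
    then show ?case
      by (rule degree_less_cong) (use Suc.prems assms in \<open>auto simp: vertex_apply\<close>)
  qed
  from this[OF order_refl]
  show "degree_less G (k + 1) {1..n} (\<lambda>T. ordered_product G a (vertex n T) n)"
    by (rule degree_less_mono) (use assms(1) in simp)
qed simp

lemma Dk_cubes_presheaf:
  assumes "f \<in> Dk_cubes G k m" and \<phi>: "cube_morphism n m \<phi>"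
  shows "compose (cube n) f \<phi> \<in> Dk_cubes G k n"
proof -
  \<comment> \<open>The morphism read on supports; its coordinates then have the form required by
    \<open>degree_less_comp\<close>.\<close>
  define \<Phi> where "\<Phi> T = {i \<in> {1..m}. \<phi> (vertex n T) i = 1}" for T
  have \<Phi>: "vertex m (\<Phi> T) = \<phi> (vertex n T)" for T
    unfolding \<Phi>_def by (intro vertex_support cube_morphism_closed[OF \<phi>]) simp
  have "degree_less G (k + 1) {1..n} (\<lambda>T. f (vertex m (\<Phi> T)))"
  proof (rule degree_less_comp[where \<Phi> = \<Phi>, OF _ _ Dk_cubes_degree_less[OF assms(1)]])
    fix i assume i: "i \<in> {1..m}"
    show "(\<exists>b. \<forall>T\<subseteq>{1..n}. (i \<in> \<Phi> T) = b) \<or>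
      (\<exists>j\<in>{1..n}. (\<forall>T\<subseteq>{1..n}. i \<in> \<Phi> T \<longleftrightarrow> j \<in> T) \<or> (\<forall>T\<subseteq>{1..n}. i \<in> \<Phi> T \<longleftrightarrow> j \<notin> T))"
      using \<phi> i
    proof (cases rule: cube_morphismE)
      case (1 b)
      then show ?thesis using i by (intro disjI1 exI[of _ "b = 1"]) (simp add: \<Phi>_def)
    next
      case (2 j)
      then show ?thesis using i by (intro disjI2 bexI[of _ j] disjI1) (auto simp: \<Phi>_def)
    next
      case (3 j)
      then show ?thesis using i
        by (intro disjI2 bexI[of _ j] disjI2) (auto simp: \<Phi>_def vertex_apply)
    qed
  qed (auto simp: \<Phi>_def)
  then show ?thesis
    unfolding compose_def by (rule Dk_cubesI) (simp add: \<Phi>)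
qed

lemma Dk_cubes_eq_one_at_ones:
  assumes "f \<in> Dk_cubes G k n" "k + 1 \<le> n" "\<And>x. x \<in> punctured_cube n \<Longrightarrow> f x = \<one>"
  shows "f (ones n) = \<one>"
  unfolding ones_eq_vertex
proof (rule degree_less_eq_oneI[OF _ Dk_cubes_degree_less[OF assms(1)]])
  fix T assume "T \<subset> {1..n}"
  then show "f (vertex n T) = \<one>"
    by (intro assms(3)) (auto simp: punctured_cube_iff)
qed (use assms(2) in auto)

text \<open>The faces are given by cubes of full dimension \<open>n\<close>, which avoids
  renumbering coordinates; restricting the set of coordinates to \<open>{1..n} - {i}\<close> then
  yields the hypothesis of \<open>degree_less_completion\<close>.\<close>

lemma Dk_cubes_completion:
  assumes closed: "\<And>x. x \<in> cube n \<Longrightarrow> f x \<in> carrier G"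
    and faces: "\<And>i. i \<in> {1..n} \<Longrightarrow> \<exists>g \<in> Dk_cubes G k n. \<forall>x\<in>cube n. x i = 0 \<longrightarrow> g x = f x"
  shows "\<exists>h \<in> Dk_cubes G k n. \<forall>x\<in>punctured_cube n. h x = f x"
proof -
  define F where "F T = f (vertex n T)" for T
  have F: "F \<in> Pow {1..n} \<rightarrow> carrier G" using closed by (simp add: F_def)
  have "degree_less G (k + 1) ({1..n} - {i}) F" if i: "i \<in> {1..n}" for i
  proof -
    obtain g where g: "g \<in> Dk_cubes G k n" "\<And>x. x \<in> cube n \<Longrightarrow> x i = 0 \<Longrightarrow> g x = f x"
      using faces[OF i] by blast
    show ?thesis
    proof (rule degree_less_cong[OF degree_less_subset[OF Dk_cubes_degree_less[OF g(1)]]])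
      fix T assume "T \<subseteq> {1..n} - {i}"
      then have "vertex n T i = 0" using i by auto
      then show "F T = g (vertex n T)" by (simp add: F_def g(2))
    qed auto
  qed
  then obtain c where c: "degree_less G (k + 1) {1..n} (F({1..n} := c))"
    using degree_less_completion[OF _ F] by blast
  define h where "h x = (if x = ones n then c else f x)" for x
  have "(\<lambda>x\<in>cube n. h x) \<in> Dk_cubes G k n"
    using c by (rule Dk_cubesI) (use vertex_inject in \<open>auto simp: h_def F_def ones_eq_vertex\<close>)
  then show ?thesis
    by (rule bexI[rotated]) (auto simp: h_def punctured_cube_def)
qed

end


section \<open>Ordered products\<close>

lemma ordered_product_cong:
  assumes "\<And>t. t \<le> n \<Longrightarrow> a t = b t" "\<And>t. t \<in> {1..n} \<Longrightarrow> v t = w t"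
  shows "ordered_product G a v n = ordered_product G b w n"
  using assms by (induction n) auto

context group
begin

section \<open>Rearranging ordered products in a group\<close>

lemma ordered_product_closed [simp]:
  "(\<And>t. a t \<in> carrier G) \<Longrightarrow> ordered_product G a v n \<in> carrier G"
  by (induction n) auto

lemma ordered_product_at_origin:
  assumes "\<And>t. a t \<in> carrier G" "\<And>t. t \<in> {1..n} \<Longrightarrow> v t = 0"
  shows "ordered_product G a v n = a 0"
  using assms by (induction n) auto

text \<open>With \<open>ordered_product_at_origin\<close> this lets every coefficient be read off
  from the values at the origin and the unit vectors.\<close>

lemma ordered_product_at_unit:
  assumes "\<And>t. a t \<in> carrier G" "j \<in> {1..n}"
  shows "ordered_product G a (vertex n {j}) n = a 0 \<otimes> a j"
proof -
  have "ordered_product G a (vertex n {j}) m = (if j \<le> m then a 0 \<otimes> a j else a 0)"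
    if "m \<le> n" for m
    using that
  proof (induction m)
    case 0
    then show ?case using assms(2) by simp
  next
    case (Suc m)
    then have "vertex n {j} (Suc m) = (if Suc m = j then 1 else 0)" by (simp add: vertex_apply)
    then show ?case using Suc assms by (auto simp: le_Suc_eq)
  qed
  then show ?thesis using assms(2) by simp
qed

lemma ordered_product_extend:
  assumes "\<And>t. a t \<in> carrier G" "l \<le> n"
  shows "ordered_product G (\<lambda>t. if t \<le> l then a t else \<one>) v n = ordered_product G a v l"
  using assms(2)
proof (induction n rule: dec_induct)
  case base
  show ?case by (rule ordered_product_cong) auto
qed (simp add: assms(1))

text \<open>Moving \<open>c\<close> to the left past a factor conjugates its coefficient by
  \<open>c\<close>; in the end \<open>c\<close> is absorbed into \<open>a 0\<close>.\<close>

lemma ordered_product_mult_const: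
  assumes a: "\<And>t. a t \<in> carrier G" and c: "c \<in> carrier G" and v: "v \<in> cube n" and l: "l \<le> n"
  shows "ordered_product G a v l \<otimes> c
    = ordered_product G (\<lambda>t. if t = 0 then a 0 \<otimes> c else inv c \<otimes> a t \<otimes> c) v l"
  using l
proof (induction l)
  case (Suc l)
  let ?b = "\<lambda>t. if t = 0 then a 0 \<otimes> c else inv c \<otimes> a t \<otimes> c"
  have p: "a (Suc l) [^] v (Suc l) \<otimes> c = c \<otimes> ?b (Suc l) [^] v (Suc l)"
    using cube_values[OF v, of "Suc l"] Suc.prems a[of "Suc l"] c
    by (auto simp: m_assoc[symmetric])
  have "ordered_product G a v (Suc l) \<otimes> c
      = ordered_product G a v l \<otimes> c \<otimes> ?b (Suc l) [^] v (Suc l)"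
    using a c p by (simp add: m_assoc)
  then show ?case using Suc by simp
qed simp

text \<open>Only the last factor changes. As \<open>v j\<close> is 0 or 1, the two powers merge even
  when \<open>a j\<close> and \<open>c\<close> do not commute.\<close>

lemma ordered_product_mult_pow:
  assumes a: "\<And>t. a t \<in> carrier G" and c: "c \<in> carrier G" and v: "v \<in> cube n" and j: "j \<in> {1..n}"
  shows "ordered_product G a v j \<otimes> c [^] v j = ordered_product G (a(j := a j \<otimes> c)) v j"
proof -
  obtain i where i: "j = Suc i" using j by (cases j) auto
  have "ordered_product G (a(j := a j \<otimes> c)) v i = ordered_product G a v i"
    using i by (intro ordered_product_cong) auto
  moreover have "a j [^] v j \<otimes> c [^] v j = (a j \<otimes> c) [^] v j"
    using cube_values[OF v j] a c by auto
  ultimately show ?thesis using a c i by (simp add: m_assoc)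
qed

lemma ordered_product_presheaf:
  assumes a: "\<And>t. a t \<in> carrier G" and \<phi>: "cube_morphism n m \<phi>"
  obtains b where "\<And>t. b t \<in> carrier G"
    "\<And>v. v \<in> cube n \<Longrightarrow> ordered_product G a (\<phi> v) m = ordered_product G b v n"
proof -
  obtain \<gamma> :: "nat \<Rightarrow> nat" where \<gamma>: "\<forall>i\<in>{1..m}.
           (\<gamma> i = 0 \<and> (\<exists>b. \<forall>v\<in>cube n. \<phi> v i = b)) \<or>
           (\<gamma> i \<in> {1..n} \<and>
             ((\<forall>v\<in>cube n. \<phi> v i = v (\<gamma> i)) \<or> (\<forall>v\<in>cube n. \<phi> v i = 1 - v (\<gamma> i))))"
    "\<forall>i j. 1 \<le> i \<and> i < j \<and> j \<le> m \<longrightarrow> \<gamma> j = 0 \<or> \<gamma> i \<le> \<gamma> j"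
    using \<phi> unfolding cube_morphism_def by blast
  \<comment> \<open>The induction over the first \<open>i\<close> factors keeps track of a bound
    \<open>l\<close> on the coordinates they involve, so that a new factor can be attached at the
    right end.\<close>
  have "\<exists>b. (\<forall>t. b t \<in> carrier G) \<and>
      (\<forall>v\<in>cube n. ordered_product G a (\<phi> v) i = ordered_product G b v l)"
    if "i \<le> m" "l \<le> n" "\<forall>i'\<in>{1..i}. \<gamma> i' \<le> l" for i l
    using that
  proof (induction i arbitrary: l)
    case 0
    show ?case
      by (rule exI[of _ "\<lambda>t. if t \<le> 0 then a t else \<one>"])
        (use a ordered_product_extend[of a 0 l] in simp)
  next
    case (Suc i)
    let ?p = "\<lambda>v. a (Suc i) [^] \<phi> v (Suc i)"
    have i: "Suc i \<in> {1..m}" using Suc.prems by simp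
    show ?case
    proof (cases "\<gamma> (Suc i) = 0")
      case True
      then obtain e where e: "\<And>v. v \<in> cube n \<Longrightarrow> \<phi> v (Suc i) = e" using \<gamma>(1) i by fastforce
      obtain b where b: "\<And>t. b t \<in> carrier G"
        "\<And>v. v \<in> cube n \<Longrightarrow> ordered_product G a (\<phi> v) i = ordered_product G b v l"
        using Suc.IH[of l] Suc_leD[OF Suc.prems(1)] Suc.prems(2,3) by (metis atLeastAtMost_iff le_SucI)
      let ?c = "a (Suc i) [^] e"
      have "ordered_product G a (\<phi> v) (Suc i) =
          ordered_product G (\<lambda>t. if t = 0 then b 0 \<otimes> ?c else inv ?c \<otimes> b t \<otimes> ?c) v l"
        if "v \<in> cube n" for v
        using ordered_product_mult_const[of b ?c, OF b(1) _ that, of l] Suc.prems a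
        by (simp add: b(2) e that)
      then show ?thesis
        using a b(1) by (intro exI[of _ "\<lambda>t. if t = 0 then b 0 \<otimes> ?c else inv ?c \<otimes> b t \<otimes> ?c"]) auto
    next
      case False
      \<comment> \<open>By monotonicity the earlier factors involve only coordinates up to
        \<open>j\<close>, so the induction hypothesis is used with \<open>j\<close> in place of
        \<open>l\<close> and the new factor meets the last one.\<close>
      define j where "j = \<gamma> (Suc i)"
      have j: "j \<in> {1..n}" "j \<le> l"
        using False bspec[OF \<gamma>(1) i] Suc.prems(3) by (auto simp: j_def)
      have "\<forall>i'\<in>{1..i}. \<gamma> i' \<le> j"
      proof
        fix i' assume "i' \<in> {1..i}"
        then have "1 \<le> i' \<and> i' < Suc i \<and> Suc i \<le> m" using Suc.prems(1) by simp
        with \<gamma>(2) have "\<gamma> (Suc i) = 0 \<or> \<gamma> i' \<le> \<gamma> (Suc i)" by (elim allE impE)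
        then show "\<gamma> i' \<le> j" using False by (simp add: j_def)
      qed
      moreover have "i \<le> m" "j \<le> n" using Suc.prems(1) j(1) by auto
      ultimately obtain b where b: "\<And>t. b t \<in> carrier G"
        "\<And>v. v \<in> cube n \<Longrightarrow> ordered_product G a (\<phi> v) i = ordered_product G b v j"
        using Suc.IH[of j] by blast
      have "(\<forall>v\<in>cube n. \<phi> v (Suc i) = v j) \<or> (\<forall>v\<in>cube n. \<phi> v (Suc i) = 1 - v j)"
        using bspec[OF \<gamma>(1) i] False by (simp add: j_def)
      then have "\<exists>b'. (\<forall>t. b' t \<in> carrier G) \<and>
          (\<forall>v\<in>cube n. ordered_product G b v j \<otimes> ?p v = ordered_product G b' v j)"
      proof
        assume "\<forall>v\<in>cube n. \<phi> v (Suc i) = v j"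
        then show ?thesis
          using ordered_product_mult_pow[of b "a (Suc i)", OF b(1) a _ j(1)] a b(1)
          by (intro exI[of _ "b(j := b j \<otimes> a (Suc i))"]) auto
      next
        assume \<phi>j: "\<forall>v\<in>cube n. \<phi> v (Suc i) = 1 - v j"
        let ?x = "a (Suc i)"
        let ?b = "\<lambda>t. if t = 0 then b 0 \<otimes> ?x else inv ?x \<otimes> b t \<otimes> ?x"
        have bc: "\<And>t. ?b t \<in> carrier G" using a b(1) by auto
        have "ordered_product G b v j \<otimes> ?p v
            = ordered_product G (?b(j := ?b j \<otimes> inv ?x)) v j" if v: "v \<in> cube n" for v
        proof -
          \<comment> \<open>The power with exponent \<open>1 - v j\<close> is a constant, moved to
            the left by conjugation, times a power with exponent \<open>v j\<close>, merged into the
            last factor.\<close>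
          have "?p v = ?x \<otimes> inv ?x [^] v j"
            using cube_values[OF v j(1)] \<phi>j v a by auto
          then have "ordered_product G b v j \<otimes> ?p v
              = ordered_product G b v j \<otimes> ?x \<otimes> inv ?x [^] v j"
            using a b(1) by (simp add: m_assoc)
          also have "\<dots> = ordered_product G ?b v j \<otimes> inv ?x [^] v j"
            using ordered_product_mult_const[of b ?x, OF b(1) a v, of j] j(1) by simp
          also have "\<dots> = ordered_product G (?b(j := ?b j \<otimes> inv ?x)) v j"
            by (rule ordered_product_mult_pow[of ?b, OF bc inv_closed[OF a] v j(1)])
          finally show ?thesis .
        qed
        moreover have "\<forall>t. (?b(j := ?b j \<otimes> inv ?x)) t \<in> carrier G"
          using a b(1) by auto
        ultimately show ?thesis by blast
      qed
      then obtain b' where b': "\<And>t. b' t \<in> carrier G"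
        "\<And>v. v \<in> cube n \<Longrightarrow> ordered_product G b v j \<otimes> ?p v = ordered_product G b' v j"
        by blast
      show ?thesis
        \<comment> \<open>Trivial coefficients fill the coordinates from \<open>j + 1\<close> to
          \<open>l\<close>.\<close>
        by (rule exI[of _ "\<lambda>t. if t \<le> j then b' t else \<one>"])
          (use b' b(2) ordered_product_extend[of b', OF b'(1) j(2)] in simp)
    qed
  qed
  from this[of m n] \<gamma>(1) show thesis
    using that by (metis atLeastAtMost_iff le0 order_refl)
qed

text \<open>The definition constrains the coefficients only up to \<open>n\<close>; filling up with
  \<open>\<one>\<close> puts all of them into the group, as the lemmas on ordered products
  ask.\<close>

lemma D1_cubesE:
  assumes "g \<in> D1_cubes G n"
  obtains a where "\<And>t. a t \<in> carrier G" "\<And>x. x \<in> cube n \<Longrightarrow> g x = ordered_product G a x n"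
proof -
  obtain a where a: "a \<in> {0..n} \<rightarrow> carrier G" "\<And>x. x \<in> cube n \<Longrightarrow> g x = ordered_product G a x n"
    using assms unfolding D1_cubes_def by blast
  let ?b = "\<lambda>t. if t \<le> n then a t else \<one>"
  have "g x = ordered_product G ?b x n" if "x \<in> cube n" for x
    unfolding a(2)[OF that] by (rule ordered_product_cong) auto
  moreover have "?b t \<in> carrier G" for t using a(1) by auto
  ultimately show thesis using that[of ?b] by blast
qed

lemma D1_cubesI:
  "(\<And>t. a t \<in> carrier G) \<Longrightarrow> (\<lambda>x\<in>cube n. ordered_product G a x n) \<in> D1_cubes G n"
  unfolding D1_cubes_def by auto

end

section \<open>Translation by a central subgroup\<close>

locale central_subgroup = group G + subgroup Z G for G (structure) and Z +
  assumes central: "z \<in> Z \<Longrightarrow> x \<in> carrier G \<Longrightarrow> z \<otimes> x = x \<otimes> z"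
begin

lemma mem_carrier_Z [simp]: "z \<in> Z \<Longrightarrow> z \<in> carrier G"
  using subset by blast

sublocale ZG: comm_group "G\<lparr>carrier := Z\<rparr>"
proof -
  interpret group "G\<lparr>carrier := Z\<rparr>"
    by (rule subgroup_imp_group) (rule subgroup_axioms)
  show "comm_group (G\<lparr>carrier := Z\<rparr>)"
    by unfold_locales (simp add: central)
qed

lemma ordered_product_Z: "ordered_product (G\<lparr>carrier := Z\<rparr>) w v n = ordered_product G w v n"
  by (induction n) (simp_all add: nat_pow_consistent[symmetric])

text \<open>Central coefficients can be collected on the left, and the exponents are 0 or 1.\<close>

lemma ordered_product_mult_central:
  assumes "\<And>t. w t \<in> Z" "\<And>t. a t \<in> carrier G" "v \<in> cube n" "l \<le> n"
  shows "ordered_product G (\<lambda>t. w t \<otimes> a t) v l = ordered_product G w v l \<otimes> ordered_product G a v l"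
  using assms(4)
proof (induction l)
  case (Suc l)
  let ?W = "ordered_product G w v l" and ?A = "ordered_product G a v l"
  have c: "?W \<in> carrier G" "?A \<in> carrier G" using assms(1,2) by auto
  have "v (Suc l) = 0 \<or> v (Suc l) = 1"
    using cube_values[OF assms(3)] Suc.prems by simp
  moreover have "?W \<otimes> ?A \<otimes> (w (Suc l) \<otimes> a (Suc l)) = ?W \<otimes> w (Suc l) \<otimes> (?A \<otimes> a (Suc l))"
    using c assms(1,2) central[of "w (Suc l)" ?A]
    by (simp add: m_assoc) (simp add: m_assoc[symmetric])
  ultimately show ?case using Suc c assms(1,2) by auto
qed simp

lemma Dk_Z_closed: "f \<in> Dk_cubes (G\<lparr>carrier := Z\<rparr>) k n \<Longrightarrow> x \<in> cube n \<Longrightarrow> f x \<in> Z"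
  by (auto simp: Dk_cubes_def)

lemma Dk_Z_mult:
  assumes "f \<in> Dk_cubes (G\<lparr>carrier := Z\<rparr>) k n" "g \<in> Dk_cubes (G\<lparr>carrier := Z\<rparr>) k n"
  shows "(\<lambda>x\<in>cube n. f x \<otimes> g x) \<in> Dk_cubes (G\<lparr>carrier := Z\<rparr>) k n"
  using ZG.Dk_cubes_mult[OF assms] by simp

lemma Dk_Z_inv:
  assumes "f \<in> Dk_cubes (G\<lparr>carrier := Z\<rparr>) k n"
  shows "(\<lambda>x\<in>cube n. inv (f x)) \<in> Dk_cubes (G\<lparr>carrier := Z\<rparr>) k n"
proof -
  have "(\<lambda>x\<in>cube n. inv (f x)) = (\<lambda>x\<in>cube n. inv\<^bsub>G\<lparr>carrier := Z\<rparr>\<^esub> (f x))"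
    using m_inv_consistent[OF subgroup_axioms] Dk_Z_closed[OF assms] by (auto simp: restrict_def)
  then show ?thesis using ZG.Dk_cubes_inv[OF assms] by simp
qed

lemma Dk_Z_ordered_product:
  "k \<ge> 1 \<Longrightarrow> (\<And>t. w t \<in> Z) \<Longrightarrow>
    (\<lambda>x\<in>cube n. ordered_product G w x n) \<in> Dk_cubes (G\<lparr>carrier := Z\<rparr>) k n"
  using ZG.Dk_cubes_ordered_product[of k w n] by (simp add: ordered_product_Z)

section \<open>Cubes of H_{Z,k}(G)\<close>

lemma H_cubesI:
  assumes "f \<in> Dk_cubes (G\<lparr>carrier := Z\<rparr>) k n" "\<And>t. a t \<in> carrier G"
    and "c \<in> extensional (cube n)"
    and c: "\<And>x. x \<in> cube n \<Longrightarrow> c x = f x \<otimes> ordered_product G a x n"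
  shows "c \<in> H_cubes G Z k n"
proof -
  have "c x \<in> carrier G" if "x \<in> cube n" for x
    using c[OF that] Dk_Z_closed[OF assms(1) that] assms(2) by simp
  then show ?thesis
    unfolding H_cubes_def using assms D1_cubesI[of a n]
    by (intro CollectI conjI bexI[of _ f] bexI[of _ "\<lambda>x\<in>cube n. ordered_product G a x n"])
      (auto simp: PiE_def)
qed

lemma H_cubesE:
  assumes "c \<in> H_cubes G Z k n"
  obtains f a where "f \<in> Dk_cubes (G\<lparr>carrier := Z\<rparr>) k n" "\<And>t. a t \<in> carrier G"
    "\<And>x. x \<in> cube n \<Longrightarrow> c x = f x \<otimes> ordered_product G a x n"
proof -
  obtain f g where fg: "f \<in> Dk_cubes (G\<lparr>carrier := Z\<rparr>) k n" "g \<in> D1_cubes G n"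
    "\<And>x. x \<in> cube n \<Longrightarrow> c x = f x \<otimes> g x"
    using assms unfolding H_cubes_def by blast
  obtain a where "\<And>t. a t \<in> carrier G" "\<And>x. x \<in> cube n \<Longrightarrow> g x = ordered_product G a x n"
    using D1_cubesE[OF fg(2)] by blast
  with fg that[of f a] show thesis by auto
qed

lemma H_cubes_presheaf:
  assumes "\<psi> \<in> H_cubes G Z k m" and \<phi>: "cube_morphism n m \<phi>"
  shows "compose (cube n) \<psi> \<phi> \<in> H_cubes G Z k n"
proof -
  obtain f a where f: "f \<in> Dk_cubes (G\<lparr>carrier := Z\<rparr>) k m" and a: "\<And>t. a t \<in> carrier G"
    and c: "\<And>x. x \<in> cube m \<Longrightarrow> \<psi> x = f x \<otimes> ordered_product G a x m"
    using H_cubesE[OF assms(1)] by blast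
  obtain b where b: "\<And>t. b t \<in> carrier G"
    "\<And>v. v \<in> cube n \<Longrightarrow> ordered_product G a (\<phi> v) m = ordered_product G b v n"
    using ordered_product_presheaf[of a, OF a \<phi>] by blast
  show ?thesis
  proof (rule H_cubesI[OF ZG.Dk_cubes_presheaf[OF f \<phi>]])
    show "b t \<in> carrier G" for t by (rule b(1))
    fix v assume v: "v \<in> cube n"
    from cube_morphism_closed[OF \<phi> v] show "compose (cube n) \<psi> \<phi> v = compose (cube n) f \<phi> v \<otimes> ordered_product G b v n"
      by (simp only: compose_eq[OF v] c b(2)[OF v])
  qed (rule compose_extensional)
qed

lemma H_cubes_1: "k \<ge> 1 \<Longrightarrow> H_cubes G Z k 1 = (cube 1 \<rightarrow>\<^sub>E carrier G)"
proof (intro equalityI subsetI)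
  fix c assume k: "k \<ge> 1" and c: "c \<in> cube 1 \<rightarrow>\<^sub>E carrier G"
  let ?o = "vertex 1 {}" and ?e = "vertex 1 {1}"
  \<comment> \<open>The solution of \<open>a 0 = c ?o\<close> and
    \<open>a 0 \<otimes> a 1 = c ?e\<close>; the D_k factor is taken trivial.\<close>
  define a where "a t = (if t = 0 then c ?o else inv (c ?o) \<otimes> c ?e)" for t :: nat
  have cc: "c ?o \<in> carrier G" "c ?e \<in> carrier G" using c by auto
  show "c \<in> H_cubes G Z k 1"
  proof (rule H_cubesI[OF Dk_Z_ordered_product[OF k, of "\<lambda>_. \<one>"]])
    show "a t \<in> carrier G" for t using cc by (simp add: a_def)
    fix x assume x: "x \<in> cube 1"
    have "x = ?o \<or> x = ?e"
      using cube_values[OF x, of 1] cube_eqI[OF x vertex_in_cube, of "{}"]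
        cube_eqI[OF x vertex_in_cube, of "{1}"] by auto
    then have "c x = ordered_product G a x 1"
      using cc by (auto simp: a_def vertex_apply m_assoc[symmetric])
    then show "c x = (\<lambda>x\<in>cube 1. ordered_product G (\<lambda>_. \<one>) x 1) x \<otimes> ordered_product G a x 1"
      using cc x by (simp add: a_def)
  qed (use c in \<open>auto simp: PiE_def\<close>)
qed (simp add: H_cubes_def)

text \<open>The values at the origin and the unit vectors show that the coefficients agree modulo
  \<open>Z\<close>, and the central quotients form an ordered product in \<open>Z\<close>, a cube of
  D_k(Z) as \<open>k \<ge> 1\<close>. The coordinates in \<open>I\<close> are those kept at 0: a
  single one for a face, none for uniqueness.\<close>

lemma ordered_product_compare:
  assumes k: "k \<ge> 1" and a: "\<And>t. a t \<in> carrier G" and b: "\<And>t. b t \<in> carrier G"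
    and zero: "\<exists>z\<in>Z. ordered_product G b (vertex n {}) n = z \<otimes> ordered_product G a (vertex n {}) n"
    and unit: "\<And>j. j \<in> {1..n} - I \<Longrightarrow>
      \<exists>z\<in>Z. ordered_product G b (vertex n {j}) n = z \<otimes> ordered_product G a (vertex n {j}) n"
  obtains h where "h \<in> Dk_cubes (G\<lparr>carrier := Z\<rparr>) k n"
    "\<And>x. x \<in> cube n \<Longrightarrow> \<forall>i\<in>I. x i = 0 \<Longrightarrow>
      ordered_product G b x n = h x \<otimes> ordered_product G a x n"
proof -
  have "ordered_product G c (vertex n {}) n = c 0" if "\<And>t. c t \<in> carrier G" for c
    using that by (intro ordered_product_at_origin) (auto simp: vertex_apply)
  then obtain z where z: "z \<in> Z" "b 0 = z \<otimes> a 0" using zero a b by auto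
  have "\<exists>w\<in>Z. b j = w \<otimes> a j" if j: "j \<in> {1..n} - I" for j
  proof -
    obtain y where y: "y \<in> Z" "b 0 \<otimes> b j = y \<otimes> (a 0 \<otimes> a j)"
      using unit[OF j] j a b by (auto simp: ordered_product_at_unit)
    \<comment> \<open>Centrality moves \<open>a 0\<close> to the front on both sides, where it
      cancels.\<close>
    have "z \<otimes> a 0 \<otimes> b j = a 0 \<otimes> (z \<otimes> b j)"
      using z a b central[of z "a 0"] by (simp add: m_assoc)
    moreover have "y \<otimes> (a 0 \<otimes> a j) = a 0 \<otimes> (y \<otimes> a j)"
      using y a central[of y "a 0"] by (simp add: m_assoc[symmetric])
    ultimately have "z \<otimes> b j = y \<otimes> a j"
      using y z a b by simp
    then have "b j = inv z \<otimes> y \<otimes> a j"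
      using y z a b by (simp add: m_assoc inv_solve_left)
    then show ?thesis using y z by (intro bexI[of _ "inv z \<otimes> y"]) auto
  qed
  then obtain u where u: "\<And>j. j \<in> {1..n} - I \<Longrightarrow> u j \<in> Z \<and> b j = u j \<otimes> a j" by metis
  \<comment> \<open>On \<open>I\<close> the quotient of the coefficients may lie outside
    \<open>Z\<close>, but there the exponents are 0, so \<open>\<one>\<close> serves.\<close>
  define w where "w t = (if t = 0 then z else if t \<in> {1..n} - I then u t else \<one>)" for t
  have w: "w t \<in> Z" for t using z u by (auto simp: w_def)
  show thesis
  proof (rule that[OF Dk_Z_ordered_product[of k w, OF k w]])
    fix x assume x: "x \<in> cube n" "\<forall>i\<in>I. x i = 0"
    have "ordered_product G b x m = ordered_product G (\<lambda>t. w t \<otimes> a t) x m" if "m \<le> n" for m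
      using that
    proof (induction m)
      case 0
      then show ?case using z by (simp add: w_def)
    next
      case (Suc m)
      have "b (Suc m) [^] x (Suc m) = (w (Suc m) \<otimes> a (Suc m)) [^] x (Suc m)"
      proof (cases "Suc m \<in> I")
        case False
        then show ?thesis using u[of "Suc m"] Suc.prems by (simp add: w_def)
      qed (use x in simp)
      then show ?case using Suc by simp
    qed
    then show "ordered_product G b x n
        = (\<lambda>x\<in>cube n. ordered_product G w x n) x \<otimes> ordered_product G a x n"
      using ordered_product_mult_central[of w a, OF w a x(1), of n] x(1) by simp
  qed
qed

text \<open>The face cube is pulled back along the projection forgetting coordinate
  \<open>i\<close>, which on the face \<open>x i = 0\<close> is inverse to the face
  embedding.\<close>

lemma H_cubes_degenerate:
  assumes i: "i \<in> {1..n}" and f: "compose (cube (n - 1)) f (face n i 0) \<in> H_cubes G Z k (n - 1)"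
  obtains c where "c \<in> H_cubes G Z k n" "\<And>x. x \<in> cube n \<Longrightarrow> x i = 0 \<Longrightarrow> c x = f x"
proof -
  define \<gamma> where "\<gamma> l = (if l < i then l else Suc l)" for l
  define \<sigma> where "\<sigma> = (\<lambda>x\<in>cube n. \<lambda>l\<in>{1..n - 1}. x (\<gamma> l))"
  have \<gamma>: "\<gamma> l \<in> {1..n}" if "l \<in> {1..n - 1}" for l
    using that i by (auto simp: \<gamma>_def)
  have \<sigma>_cube: "\<sigma> x \<in> cube (n - 1)" if "x \<in> cube n" for x
    using cube_values[OF that] \<gamma> that by (auto simp: \<sigma>_def cube_def)
  have "cube_morphism n (n - 1) \<sigma>"
    unfolding cube_morphism_def
  proof (intro conjI exI[of _ \<gamma>])
    show "\<sigma> \<in> cube n \<rightarrow>\<^sub>E cube (n - 1)"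
      using \<sigma>_cube by (intro PiE_I) (simp_all add: \<sigma>_def)
    show "\<forall>l\<in>{1..n - 1}. (\<gamma> l = 0 \<and> (\<exists>b. \<forall>v\<in>cube n. \<sigma> v l = b)) \<or>
      (\<gamma> l \<in> {1..n} \<and> ((\<forall>v\<in>cube n. \<sigma> v l = v (\<gamma> l)) \<or> (\<forall>v\<in>cube n. \<sigma> v l = 1 - v (\<gamma> l))))"
      using \<gamma> by (simp add: \<sigma>_def)
    show "\<forall>l m. 1 \<le> l \<and> l < m \<and> m \<le> n - 1 \<longrightarrow> \<gamma> m = 0 \<or> \<gamma> l \<le> \<gamma> m"
      by (simp add: \<gamma>_def)
  qed
  moreover have "compose (cube n) (compose (cube (n - 1)) f (face n i 0)) \<sigma> x = f x"
    if x: "x \<in> cube n" "x i = 0" for x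
  proof -
    have "face n i 0 (\<sigma> x) = x"
    proof (rule PiE_ext)
      show "x \<in> {1..n} \<rightarrow>\<^sub>E UNIV" using x by (auto simp: cube_def PiE_def)
      show "face n i 0 (\<sigma> x) l = x l" if "l \<in> {1..n}" for l
        using that i x by (auto simp: face_def \<sigma>_def \<gamma>_def)
    qed (auto simp: face_def)
    then show ?thesis using \<sigma>_cube x(1) by (simp add: compose_eq)
  qed
  ultimately show thesis using that H_cubes_presheaf[OF f] by blast
qed

text \<open>Modulo \<open>Z\<close> the map \<open>f\<close> is a corner of \<open>\<D>\<^sub>1(G/Z)\<close>, so it agrees there with the cube \<open>g\<close> read off from
  its values at the origin and at the unit vectors; \<open>f g\<^sup>-\<^sup>1\<close> is then a corner of \<open>\<D>\<^sub>k(Z)\<close>.\<close>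

lemma H_cubes_completion:
  assumes k: "k \<ge> 1" and closed: "\<And>x. x \<in> punctured_cube n \<Longrightarrow> f x \<in> carrier G"
    and faces: "\<And>i. i \<in> {1..n} \<Longrightarrow> \<exists>c \<in> H_cubes G Z k n. \<forall>x\<in>cube n. x i = 0 \<longrightarrow> c x = f x"
  obtains \<phi> where "\<phi> \<in> H_cubes G Z k n" "\<And>x. x \<in> punctured_cube n \<Longrightarrow> \<phi> x = f x"
proof -
  \<comment> \<open>For \<open>n \<le> 1\<close> the origin or the unit vector is the top vertex,
    where \<open>f\<close> is not prescribed; the default \<open>\<one>\<close> keeps the
    coefficients \<open>a\<close> in the group.\<close>
  define f' where "f' x = (if x \<in> punctured_cube n then f x else \<one>)" for x
  have f': "f' x \<in> carrier G" for x using closed by (simp add: f'_def)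
  define a where "a t = (if t = 0 then f' (vertex n {})
    else inv (f' (vertex n {})) \<otimes> f' (vertex n {t}))" for t
  have a: "a t \<in> carrier G" for t using f' by (simp add: a_def)
  let ?g = "\<lambda>x. ordered_product G a x n"
  have g: "?g x \<in> carrier G" for x using a by simp
  have g0: "?g (vertex n {}) = f' (vertex n {})"
    using ordered_product_at_origin[of a n "vertex n {}", OF a] by (simp add: a_def)
  have gj: "?g (vertex n {j}) = f' (vertex n {j})" if "j \<in> {1..n}" for j
    using ordered_product_at_unit[of a, OF a that] that f' by (auto simp: a_def m_assoc[symmetric])
  have face: "\<exists>h \<in> Dk_cubes (G\<lparr>carrier := Z\<rparr>) k n. \<forall>x\<in>cube n. x i = 0 \<longrightarrow> f x = h x \<otimes> ?g x"
    if i: "i \<in> {1..n}" for i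
  proof -
    obtain c where c: "c \<in> H_cubes G Z k n" "\<And>x. x \<in> cube n \<Longrightarrow> x i = 0 \<Longrightarrow> c x = f x"
      using faces[OF i] by blast
    obtain z b where z: "z \<in> Dk_cubes (G\<lparr>carrier := Z\<rparr>) k n" and b: "\<And>t. b t \<in> carrier G"
      and czb: "\<And>x. x \<in> cube n \<Longrightarrow> c x = z x \<otimes> ordered_product G b x n"
      using H_cubesE[OF c(1)] by blast
    have eq: "f' x = z x \<otimes> ordered_product G b x n" if "x \<in> cube n" "x i = 0" for x
    proof -
      have "x \<in> punctured_cube n" using that i by (auto simp: punctured_cube_iff)
      then show ?thesis using c(2) czb that by (simp add: f'_def)
    qed
    have solve: "\<exists>y\<in>Z. ordered_product G b x n = y \<otimes> f' x" if "x \<in> cube n" "x i = 0" for x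
    proof -
      have "z x \<in> Z" using Dk_Z_closed[OF z that(1)] .
      then show ?thesis
        unfolding eq[OF that] using b by (intro bexI[of _ "inv z x"]) (auto simp: m_assoc[symmetric])
    qed
    \<comment> \<open>The face \<open>x i = 0\<close> contains the origin and all unit vectors
      except that of \<open>i\<close>; hence the choice \<open>I = {i}\<close>.\<close>
    obtain h where h: "h \<in> Dk_cubes (G\<lparr>carrier := Z\<rparr>) k n"
      "\<And>x. x \<in> cube n \<Longrightarrow> \<forall>i\<in>{i}. x i = 0 \<Longrightarrow> ordered_product G b x n = h x \<otimes> ?g x"
    proof (rule ordered_product_compare[of k a b n "{i}", OF k a b])
      show "\<exists>z\<in>Z. ordered_product G b (vertex n {}) n = z \<otimes> ?g (vertex n {})"
        unfolding g0 using i by (intro solve) auto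
      show "\<exists>z\<in>Z. ordered_product G b (vertex n {j}) n = z \<otimes> ?g (vertex n {j})"
        if "j \<in> {1..n} - {i}" for j
      proof -
        have "j \<in> {1..n}" "vertex n {j} i = 0" using that i by auto
        then show ?thesis using gj solve by simp
      qed
    qed blast
    have "f x = (z x \<otimes> h x) \<otimes> ?g x" if x: "x \<in> cube n" "x i = 0" for x
    proof -
      have "f x = z x \<otimes> ordered_product G b x n" using c(2) czb x by simp
      then show ?thesis
        using h(2) x Dk_Z_closed[OF z x(1)] Dk_Z_closed[OF h(1) x(1)] g by (simp add: m_assoc)
    qed
    then show ?thesis using Dk_Z_mult[OF z h(1)] by (intro bexI) auto
  qed
  define q where "q x = f' x \<otimes> inv (?g x)" for x
  \<comment> \<open>The default at the top makes \<open>q'\<close> take values in \<open>Z\<close>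
    on the whole cube; on each face it coincides with the cube \<open>h\<close> found there.\<close>
  define q' where "q' x = (if x \<in> punctured_cube n then q x else \<one>)" for x
  have hq: "h x = q' x" if "h \<in> Dk_cubes (G\<lparr>carrier := Z\<rparr>) k n" "x \<in> cube n"
    "x i = 0" "i \<in> {1..n}" "f x = h x \<otimes> ?g x" for h x i
  proof -
    have "x \<in> punctured_cube n" using that by (auto simp: punctured_cube_iff)
    then show ?thesis
      using that(5) g Dk_Z_closed[OF that(1,2)] by (simp add: q'_def q_def f'_def m_assoc)
  qed
  have "\<exists>h \<in> Dk_cubes (G\<lparr>carrier := Z\<rparr>) k n. \<forall>x\<in>punctured_cube n. h x = q' x"
  proof (rule ZG.Dk_cubes_completion)
    fix i assume i: "i \<in> {1..n}"
    obtain h where h: "h \<in> Dk_cubes (G\<lparr>carrier := Z\<rparr>) k n"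
      "\<And>x. x \<in> cube n \<Longrightarrow> x i = 0 \<Longrightarrow> f x = h x \<otimes> ?g x"
      using face[OF i] by blast
    then show "\<exists>g \<in> Dk_cubes (G\<lparr>carrier := Z\<rparr>) k n. \<forall>x\<in>cube n. x i = 0 \<longrightarrow> g x = q' x"
      using hq[OF h(1) _ _ i] by blast
  next
    fix x assume x: "x \<in> cube n"
    have "q' x \<in> Z"
    proof (cases "x \<in> punctured_cube n")
      case True
      then obtain i where i: "i \<in> {1..n}" "x i = 0" by (auto simp: punctured_cube_iff)
      obtain h where h: "h \<in> Dk_cubes (G\<lparr>carrier := Z\<rparr>) k n" "f x = h x \<otimes> ?g x"
        using face[OF i(1)] x i(2) by blast
      show ?thesis using hq[OF h(1) x i(2,1) h(2)] Dk_Z_closed[OF h(1) x] by simp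
    qed (simp add: q'_def)
    then show "q' x \<in> carrier (G\<lparr>carrier := Z\<rparr>)" by simp
  qed
  then obtain h where h: "h \<in> Dk_cubes (G\<lparr>carrier := Z\<rparr>) k n"
    "\<And>x. x \<in> punctured_cube n \<Longrightarrow> h x = q' x" by blast
  show thesis
  proof (rule that[of "\<lambda>x\<in>cube n. h x \<otimes> ?g x"])
    show "(\<lambda>x\<in>cube n. h x \<otimes> ?g x) \<in> H_cubes G Z k n"
      by (rule H_cubesI[of h k n a, OF h(1) a]) auto
    show "(\<lambda>x\<in>cube n. h x \<otimes> ?g x) x = f x" if "x \<in> punctured_cube n" for x
      using that h(2)[OF that] g closed[OF that]
      by (simp add: punctured_cube_def q'_def q_def f'_def m_assoc)
  qed
qed

text \<open>The quotient of the two cubes turns out to be a cube of D_k(Z). It is trivial on the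
  punctured cube, hence also at the top since \<open>k + 1 \<le> n\<close>.\<close>

lemma H_cubes_unique:
  assumes k: "k \<ge> 1" and n: "k + 1 \<le> n"
    and c: "c \<in> H_cubes G Z k n" "c' \<in> H_cubes G Z k n"
    and agree: "\<And>x. x \<in> punctured_cube n \<Longrightarrow> c x = c' x"
  shows "c = c'"
proof -
  obtain z a where z: "z \<in> Dk_cubes (G\<lparr>carrier := Z\<rparr>) k n" and a: "\<And>t. a t \<in> carrier G"
    and cza: "\<And>x. x \<in> cube n \<Longrightarrow> c x = z x \<otimes> ordered_product G a x n"
    using H_cubesE[OF c(1)] by blast
  obtain y b where y: "y \<in> Dk_cubes (G\<lparr>carrier := Z\<rparr>) k n" and b: "\<And>t. b t \<in> carrier G"
    and cyb: "\<And>x. x \<in> cube n \<Longrightarrow> c' x = y x \<otimes> ordered_product G b x n"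
    using H_cubesE[OF c(2)] by blast
  have solve: "\<exists>w\<in>Z. ordered_product G b x n = w \<otimes> ordered_product G a x n"
    if "x \<in> punctured_cube n" for x
  proof -
    have x: "x \<in> cube n" using that by (simp add: punctured_cube_def)
    note zy = Dk_Z_closed[OF z x] Dk_Z_closed[OF y x]
    have "y x \<otimes> ordered_product G b x n = z x \<otimes> ordered_product G a x n"
      using agree[OF that] cza[OF x] cyb[OF x] by simp
    then have "ordered_product G b x n = inv (y x) \<otimes> z x \<otimes> ordered_product G a x n"
      using zy a b by (simp add: m_assoc inv_solve_left)
    then show ?thesis using zy by (intro bexI[of _ "inv (y x) \<otimes> z x"]) auto
  qed
  obtain h where h: "h \<in> Dk_cubes (G\<lparr>carrier := Z\<rparr>) k n"
    "\<And>x. x \<in> cube n \<Longrightarrow> ordered_product G b x n = h x \<otimes> ordered_product G a x n"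
  proof (rule ordered_product_compare[of k a b n "{}", OF k a b])
    \<comment> \<open>There are at least two coordinates, so neither the origin nor a unit vector is
      the top vertex; both cubes agree at all of them.\<close>
    have 1: "1 \<in> {1..n}" "2 \<in> {1..n}" using k n by auto
    show "\<exists>w\<in>Z. ordered_product G b (vertex n {}) n = w \<otimes> ordered_product G a (vertex n {}) n"
      by (rule solve) (use 1 in \<open>auto simp: punctured_cube_iff\<close>)
    show "\<exists>w\<in>Z. ordered_product G b (vertex n {j}) n = w \<otimes> ordered_product G a (vertex n {j}) n"
      if "j \<in> {1..n} - {}" for j
    proof (rule solve)
      have "vertex n {j} (if j = 1 then 2 else 1) = 0" using 1 by simp
      then show "vertex n {j} \<in> punctured_cube n"
        using 1 unfolding punctured_cube_iff by (metis vertex_in_cube)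
    qed
  qed auto
  \<comment> \<open>This is the quotient of \<open>c'\<close> by \<open>c\<close>: the common
    ordered product cancels and only factors in \<open>Z\<close> remain.\<close>
  define r where "r x = y x \<otimes> h x \<otimes> inv (z x)" for x
  have "(\<lambda>x\<in>cube n. (\<lambda>x\<in>cube n. y x \<otimes> h x) x \<otimes> (\<lambda>x\<in>cube n. inv (z x)) x)
      \<in> Dk_cubes (G\<lparr>carrier := Z\<rparr>) k n" (is "?r \<in> _")
    by (intro Dk_Z_mult Dk_Z_inv y h z)
  also have "?r = (\<lambda>x\<in>cube n. r x)" by (auto simp: r_def)
  finally have r: "(\<lambda>x\<in>cube n. r x) \<in> Dk_cubes (G\<lparr>carrier := Z\<rparr>) k n" .
  have r1: "c x = c' x \<longleftrightarrow> r x = \<one>" if x: "x \<in> cube n" for x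
  proof -
    note zyh = Dk_Z_closed[OF z x] Dk_Z_closed[OF y x] Dk_Z_closed[OF h(1) x]
    let ?A = "ordered_product G a x n"
    have A: "?A \<in> carrier G" using a by simp
    have "c' x = y x \<otimes> h x \<otimes> ?A"
      using cyb[OF x] h(2)[OF x] zyh A by (simp add: m_assoc)
    then have "c x = c' x \<longleftrightarrow> z x = y x \<otimes> h x"
      using cza[OF x] zyh A by simp
    also have "\<dots> \<longleftrightarrow> r x = \<one>"
      unfolding r_def using zyh inv_solve_right'[of \<one> "y x \<otimes> h x" "z x"] by auto
    finally show ?thesis .
  qed
  have p: "x \<in> cube n" if "x \<in> punctured_cube n" for x
    using that by (simp add: punctured_cube_def)
  have "(\<lambda>x\<in>cube n. r x) (ones n) = \<one>\<^bsub>G\<lparr>carrier := Z\<rparr>\<^esub>"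
    using r n by (rule ZG.Dk_cubes_eq_one_at_ones) (use agree r1 p in simp)
  then have "c (ones n) = c' (ones n)" using r1[of "ones n"] by simp
  then have "c x = c' x" if "x \<in> cube n" for x
    using agree that by (cases "x = ones n") (auto simp: punctured_cube_def)
  moreover have "c \<in> extensional (cube n)" "c' \<in> extensional (cube n)"
    using c by (auto simp: H_cubes_def PiE_def)
  ultimately show ?thesis by (intro extensionalityI)
qed

end

section \<open>The groupspace axioms and unique completion\<close>

theorem theorem10p1:
  fixes G :: "('a, 'b) monoid_scheme" and Z :: "'a set" and k :: nat
  assumes "group G"
    and "\<not> comm_group G"
    and "subgroup Z G"
    and "\<forall>z\<in>Z. \<forall>x\<in>carrier G. z \<otimes>\<^bsub>G\<^esub> x = x \<otimes>\<^bsub>G\<^esub> z"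
    and "Z \<noteq> {\<one>\<^bsub>G\<^esub>}"
    and "k \<ge> 1"
  shows "k_step_groupspace (carrier G) (H_cubes G Z k) k"
proof -
  interpret central_subgroup G Z
    using assms(1,3,4) by (intro central_subgroup.intro central_subgroup_axioms.intro) auto
  interpret cube_structure "carrier G" "H_cubes G Z k"
    by unfold_locales (auto simp: H_cubes_def)
  have exist: "\<exists>\<phi>. completion n f \<phi>" if f: "corner n f" for n f
  proof -
    obtain \<phi> where \<phi>: "\<phi> \<in> H_cubes G Z k n" "\<And>x. x \<in> punctured_cube n \<Longrightarrow> \<phi> x = f x"
    proof (rule H_cubes_completion[OF assms(6), of n f])
      show "f x \<in> carrier G" if "x \<in> punctured_cube n" for x
        using f that by (auto simp: corner_def)
      \<comment> \<open>A face cube of dimension \<open>n - 1\<close> is replaced by a degenerate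
        cube of dimension \<open>n\<close> with the same values on the face.\<close>
      show "\<exists>c \<in> H_cubes G Z k n. \<forall>x\<in>cube n. x i = 0 \<longrightarrow> c x = f x" if "i \<in> {1..n}" for i
        using f that H_cubes_degenerate[of i n f k] unfolding corner_def by metis
    qed blast
    moreover have "restrict \<phi> (punctured_cube n) = f"
      using f \<phi>(2) by (intro extensionalityI[of _ "punctured_cube n"]) (auto simp: corner_def PiE_def)
    ultimately show ?thesis by (auto simp: completion_def)
  qed
  have unique: "\<phi> = \<psi>" if "completion (k + 1) f \<phi>" "completion (k + 1) f \<psi>" for f \<phi> \<psi>
  proof (rule H_cubes_unique[OF assms(6)])
    show "\<phi> x = \<psi> x" if "x \<in> punctured_cube (k + 1)" for x
      using \<open>completion (k + 1) f \<phi>\<close> \<open>completion (k + 1) f \<psi>\<close> that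
      unfolding completion_def by (metis restrict_apply')
  qed (use that in \<open>auto simp: completion_def\<close>)
  show ?thesis
    by unfold_locales (use H_cubes_presheaf H_cubes_1[OF assms(6)] exist unique in blast)+
qed

end
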